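(* Let $h:N\to N$ be a function and let $\rho=\ker h$. Then $\widetilde{\rho}=\ker\widetilde{h}$.
   Context: $N=\{1,2,3,\dots\}$ is the set of natural numbers with the discrete topology, and $\beta N$ is its Stone-Čech compactification: the space of all ultrafilters on $N$, with topology generated by the base of (clopen) sets $\bar A=\{p\in\beta N: A\in p\}$, $A\subseteq N$. Each $n\in N$ is identified with the principal ultrafilter $\{A\subseteq N:n\in A\}$. For $h:N\to N$, $\widetilde{h}:\beta N\to\beta N$ is the unique continuous extension of $h$; explicitly $\widetilde{h}(p)=\{A\subseteq N:h^{-1}[A]\in p\}$. For a function $h:X\to Y$, its kernel is the relation $\ker h=\{(x_1,x_2)\in X^2:h(x_1)=h(x_2)\}$. For $\rho\subseteq N^2$ and $A\subseteq N$, $\rho[A]=\{n\in N:\exists m\in A\ (m,n)\in\rho\}$, and $\widetilde{\rho}=\{(p,q)\in(\beta N)^2:\forall A\in p\ \ \rho[A]\in q\}$. *)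

theory Defs
  imports "HOL-Analysis.Analysis"
begin

(* The natural numbers start at 1, so functions and relations on them are rendered on the
   carrier set NN inside nat; values outside NN play no role. *)
abbreviation NN :: "nat set" where
  "NN \<equiv> {1..}"

definition ultrafilter_on :: "'a set \<Rightarrow> 'a set set \<Rightarrow> bool" where
  "ultrafilter_on X p \<longleftrightarrow>
     p \<subseteq> Pow X \<and> X \<in> p \<and> {} \<notin> p \<and>
     (\<forall>A\<in>p. \<forall>B\<in>p. A \<inter> B \<in> p) \<and>
     (\<forall>A\<in>p. \<forall>B. A \<subseteq> B \<and> B \<subseteq> X \<longrightarrow> B \<in> p) \<and>
     (\<forall>A. A \<subseteq> X \<longrightarrow> A \<in> p \<or> X - A \<in> p)"

definition betaN :: "nat set set set" where
  "betaN = {p. ultrafilter_on NN p}"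

definition principal :: "nat \<Rightarrow> nat set set" where
  "principal n = {A. A \<subseteq> NN \<and> n \<in> A}"

definition basic_clopen :: "nat set \<Rightarrow> nat set set set" where
  "basic_clopen A = {p \<in> betaN. A \<in> p}"

definition betaN_topology :: "nat set set topology" where
  "betaN_topology = topology_generated_by (basic_clopen ` Pow NN)"

(* The explicit formula for the continuous extension of h; that it is indeed the unique
   continuous extension is proved below as beta_map_unique_continuous_extension. *)
definition beta_map :: "(nat \<Rightarrow> nat) \<Rightarrow> nat set set \<Rightarrow> nat set set" where
  "beta_map h p = {A. A \<subseteq> NN \<and> h -` A \<inter> NN \<in> p}"

(* The kernel of f : X -> Y, as a relation on the domain X. *)
definition kernel_on :: "'a set \<Rightarrow> ('a \<Rightarrow> 'b) \<Rightarrow> ('a \<times> 'a) set" where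
  "kernel_on X f = {(x, y) \<in> X \<times> X. f x = f y}"

lemma kernel_on_eq_Restr_kernel: "kernel_on X f = Restr (kernel f) X"
  by (auto simp: kernel_on_def kernel_def)

definition beta_rel :: "(nat \<times> nat) set \<Rightarrow> (nat set set \<times> nat set set) set" where
  "beta_rel \<rho> = {(p, q) \<in> betaN \<times> betaN. \<forall>A\<in>p. \<rho> `` A \<in> q}"

lemma betaN_D:
  assumes "p \<in> betaN"
  shows "p \<subseteq> Pow NN" "NN \<in> p" "{} \<notin> p"
    "\<And>A B. A \<in> p \<Longrightarrow> B \<in> p \<Longrightarrow> A \<inter> B \<in> p"
    "\<And>A B. A \<in> p \<Longrightarrow> A \<subseteq> B \<Longrightarrow> B \<subseteq> NN \<Longrightarrow> B \<in> p"
    "\<And>A. A \<subseteq> NN \<Longrightarrow> A \<in> p \<or> NN - A \<in> p"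
  using assms unfolding betaN_def ultrafilter_on_def by blast+

lemma principal_in_betaN: "n \<in> NN \<Longrightarrow> principal n \<in> betaN"
  by (auto simp: betaN_def ultrafilter_on_def principal_def)

lemma topspace_betaN_topology: "topspace betaN_topology = betaN"
proof -
  have "basic_clopen NN = betaN"
    using betaN_D(2) unfolding basic_clopen_def by blast
  then show ?thesis
    by (auto simp: betaN_topology_def basic_clopen_def)
qed

lemma openin_basic_clopen: "A \<subseteq> NN \<Longrightarrow> openin betaN_topology (basic_clopen A)"
  unfolding betaN_topology_def by (rule topology_generated_by_Basis) auto

lemma betaN_topology_base:
  assumes "openin betaN_topology U" "p \<in> U"
  shows "\<exists>A\<in>p. A \<subseteq> NN \<and> basic_clopen A \<subseteq> U"
proof -
  have "generate_topology_on (basic_clopen ` Pow NN) U"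
    using assms(1) by (simp add: betaN_topology_def openin_topology_generated_by_iff)
  then show ?thesis using assms(2)
  proof (induction U)
    case (Int U V)
    then obtain A B where AB: "A \<in> p" "A \<subseteq> NN" "basic_clopen A \<subseteq> U"
      "B \<in> p" "B \<subseteq> NN" "basic_clopen B \<subseteq> V" by blast
    have "p \<in> betaN"
    proof -
      have "U \<subseteq> betaN"
        using Int.hyps(1) openin_subset topspace_betaN_topology
        by (metis betaN_topology_def openin_topology_generated_by_iff)
      then show ?thesis using Int.prems by auto
    qed
    then have "A \<inter> B \<in> p" using AB betaN_D(4) by blast
    moreover have "basic_clopen (A \<inter> B) \<subseteq> U \<inter> V"
    proof -
      have "basic_clopen (A \<inter> B) \<subseteq> basic_clopen A \<inter> basic_clopen B"
        unfolding basic_clopen_def using AB(2,5) betaN_D(5)[of _ "A \<inter> B"] by blast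
      then show ?thesis using AB by blast
    qed
    ultimately show ?case using AB(2) by blast
  next
    case (UN K)
    then show ?case by (meson Union_iff Union_upper subset_trans)
  next
    case (Basis s)
    then show ?case by (auto simp: basic_clopen_def)
  qed auto
qed

lemma beta_map_in_betaN:
  assumes h: "h \<in> NN \<rightarrow> NN" and p: "p \<in> betaN"
  shows "beta_map h p \<in> betaN"
proof -
  note u = betaN_D[OF p]
  have 1: "h -` NN \<inter> NN = NN" using h by auto
  have 2: "h -` (A \<inter> B) \<inter> NN = (h -` A \<inter> NN) \<inter> (h -` B \<inter> NN)" for A B by auto
  have 3: "h -` (NN - A) \<inter> NN = NN - (h -` A \<inter> NN)" for A using h by auto
  show ?thesis
    unfolding betaN_def ultrafilter_on_def mem_Collect_eq
  proof (intro conjI ballI allI impI)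
    show "beta_map h p \<subseteq> Pow NN" by (auto simp: beta_map_def)
    show "NN \<in> beta_map h p" using 1 u(2) by (simp add: beta_map_def)
    show "{} \<notin> beta_map h p" using u(3) by (simp add: beta_map_def)
    show "A \<inter> B \<in> beta_map h p" if "A \<in> beta_map h p" "B \<in> beta_map h p" for A B
      using that u(4) unfolding beta_map_def mem_Collect_eq 2 by blast
    show "B \<in> beta_map h p" if "A \<in> beta_map h p" "A \<subseteq> B \<and> B \<subseteq> NN" for A B
      using that u(5)[of "h -` A \<inter> NN" "h -` B \<inter> NN"] unfolding beta_map_def by blast
    show "A \<in> beta_map h p \<or> NN - A \<in> beta_map h p" if "A \<subseteq> NN" for A
      using that u(6)[of "h -` A \<inter> NN"] unfolding beta_map_def mem_Collect_eq 3 by blast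
  qed
qed

lemma continuous_map_beta_map:
  assumes h: "h \<in> NN \<rightarrow> NN"
  shows "continuous_map betaN_topology betaN_topology (beta_map h)"
proof -
  have "\<exists>V. openin betaN_topology V \<and> p \<in> V \<and> V \<subseteq> {q \<in> betaN. beta_map h q \<in> U}"
    if U: "openin betaN_topology U" and p: "p \<in> betaN" "beta_map h p \<in> U" for U p
  proof -
    obtain A where A: "A \<in> beta_map h p" "A \<subseteq> NN" "basic_clopen A \<subseteq> U"
      using betaN_topology_base[OF U p(2)] by blast
    have "openin betaN_topology (basic_clopen (h -` A \<inter> NN))"
      by (rule openin_basic_clopen) auto
    moreover have "p \<in> basic_clopen (h -` A \<inter> NN)"
      using A(1) p(1) by (simp add: basic_clopen_def beta_map_def)
    moreover have "basic_clopen (h -` A \<inter> NN) \<subseteq> {q \<in> betaN. beta_map h q \<in> U}"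
      using A(2,3) beta_map_in_betaN[OF h] unfolding basic_clopen_def beta_map_def by blast
    ultimately show ?thesis by blast
  qed
  then have "openin betaN_topology {q \<in> betaN. beta_map h q \<in> U}"
    if "openin betaN_topology U" for U
    using that by (subst openin_subopen) blast
  then show ?thesis
    using beta_map_in_betaN[OF h] by (auto simp: continuous_map_def topspace_betaN_topology)
qed

lemma beta_map_principal:
  assumes "h \<in> NN \<rightarrow> NN" "n \<in> NN"
  shows "beta_map h (principal n) = principal (h n)"
  using assms by (auto simp: beta_map_def principal_def)

theorem beta_map_unique_continuous_extension:
  assumes h: "h \<in> NN \<rightarrow> NN"
  shows "continuous_map betaN_topology betaN_topology g \<and>
           (\<forall>n\<in>NN. g (principal n) = principal (h n)) \<longleftrightarrow>
         (\<forall>p\<in>betaN. g p = beta_map h p)"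
proof (intro iffI conjI ballI)
  fix p
  assume g: "continuous_map betaN_topology betaN_topology g \<and>
           (\<forall>n\<in>NN. g (principal n) = principal (h n))"
    and p: "p \<in> betaN"
  have gp: "g p \<in> betaN"
    using g p by (auto simp: continuous_map_def topspace_betaN_topology)
  have hp: "beta_map h p \<in> betaN" using h p by (rule beta_map_in_betaN)
  have sub: "A \<in> beta_map h p" if "A \<in> g p" for A
  proof (rule ccontr)
    assume nA: "A \<notin> beta_map h p"
    have A: "A \<subseteq> NN" using betaN_D(1)[OF gp] that by blast
    then have "NN - A \<in> beta_map h p" using betaN_D(6)[OF hp] nA by blast
    then have cA: "h -` (NN - A) \<inter> NN \<in> p" by (simp add: beta_map_def)
    have "openin betaN_topology {q \<in> betaN. g q \<in> basic_clopen A}"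
      using g openin_basic_clopen[OF A]
      unfolding continuous_map_def topspace_betaN_topology by blast
    then obtain B where B: "B \<in> p" "B \<subseteq> NN" "basic_clopen B \<subseteq> {q \<in> betaN. g q \<in> basic_clopen A}"
      using betaN_topology_base[of "{q \<in> betaN. g q \<in> basic_clopen A}" p] p gp \<open>A \<in> g p\<close>
      unfolding basic_clopen_def by blast
    have "B \<inter> (h -` (NN - A) \<inter> NN) \<noteq> {}"
      using betaN_D(3)[OF p] betaN_D(4)[OF p B(1) cA] by metis
    then obtain n where n: "n \<in> B" "n \<in> NN" "h n \<notin> A" by blast
    then have "principal n \<in> basic_clopen B"
      using principal_in_betaN B(2) by (auto simp: basic_clopen_def principal_def)
    then have "A \<in> g (principal n)" using B(3) by (auto simp: basic_clopen_def)
    then show False using g n by (simp add: principal_def)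
  qed
  moreover have "A \<in> g p" if A: "A \<in> beta_map h p" for A
  proof (rule ccontr)
    assume "A \<notin> g p"
    moreover have "A \<subseteq> NN" using A by (simp add: beta_map_def)
    ultimately have "NN - A \<in> g p" using betaN_D(6)[OF gp] by blast
    then have "NN - A \<in> beta_map h p" by (rule sub)
    then have "A \<inter> (NN - A) \<in> beta_map h p"
      using A betaN_D(4)[OF hp] by blast
    then show False using betaN_D(3)[OF hp] by simp
  qed
  ultimately show "g p = beta_map h p" by blast
next
  assume g: "\<forall>p\<in>betaN. g p = beta_map h p"
  show "continuous_map betaN_topology betaN_topology g"
    using continuous_map_eq[OF continuous_map_beta_map[OF h]] g topspace_betaN_topology by metis
  show "g (principal n) = principal (h n)" if "n \<in> NN" for n
    using that g principal_in_betaN beta_map_principal[OF h] by simp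
qed

end

theory Submission
  imports Defs
begin

text \<open>
  For \<open>\<rho> = ker h\<close> the set \<open>\<rho>[A]\<close> is the saturation \<open>h\<^sup>-\<^sup>1[h[A]]\<close> of \<open>A\<close>
  (\<open>kernel_on_Image\<close>), and \<open>h\<^sup>-\<^sup>1[h[A]] \<in> q\<close> says precisely that \<open>h[A]\<close> belongs to the image
  ultrafilter of \<open>q\<close>.  The sets \<open>h[A]\<close> with \<open>A \<in> p\<close> are a filter base of the image ultrafilter
  of \<open>p\<close>.  Hence \<open>p\<close> and \<open>q\<close> are related iff the image of \<open>p\<close> is contained in the image of \<open>q\<close>,
  and containment of ultrafilters is equality (\<open>betaN_subset_imp_eq\<close>).
\<close>

text \<open>A set in \<open>q\<close> but not in \<open>p\<close> would have its complement in \<open>p \<subseteq> q\<close>, putting the empty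
  intersection of the two in \<open>q\<close>.\<close>

lemma betaN_subset_imp_eq:
  assumes p: "p \<in> betaN" and q: "q \<in> betaN" and sub: "p \<subseteq> q"
  shows "p = q"
proof
  show "q \<subseteq> p"
  proof
    fix A assume A: "A \<in> q"
    show "A \<in> p"
    proof (rule ccontr)
      assume "A \<notin> p"
      moreover have "A \<subseteq> NN" using betaN_D(1)[OF q] A by blast
      ultimately have "NN - A \<in> q" using betaN_D(6)[OF p] sub by blast
      then have "A \<inter> (NN - A) \<in> q" using A betaN_D(4)[OF q] by blast
      then show False using betaN_D(3)[OF q] by simp
    qed
  qed
qed (rule sub)

lemma kernel_on_Image:
  assumes "A \<subseteq> X"
  shows "kernel_on X h `` A = h -` (h ` A) \<inter> X"
proof -
  have "y \<in> kernel_on X h `` A \<longleftrightarrow> (\<exists>x\<in>A. h y = h x) \<and> y \<in> X" for y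
    using assms by (auto simp: kernel_on_def Image_iff subset_iff) metis
  then show ?thesis by blast
qed

lemma image_in_beta_map:
  assumes h: "h \<in> NN \<rightarrow> NN" and p: "p \<in> betaN" and A: "A \<in> p"
  shows "h ` A \<in> beta_map h p"
proof -
  have "A \<subseteq> NN" using betaN_D(1)[OF p] A by blast
  then have "h ` A \<subseteq> NN" and "A \<subseteq> h -` (h ` A) \<inter> NN" using h by blast+
  then show ?thesis using betaN_D(5)[OF p A] by (simp add: beta_map_def)
qed

text \<open>The ultrafilter form of \<open>\<rho>[A] = h\<^sup>-\<^sup>1[h[A]]\<close>: membership of a saturated set in \<open>q\<close> depends only
  on the image of \<open>q\<close>.\<close>

lemma kernel_Image_in_iff:
  assumes h: "h \<in> NN \<rightarrow> NN" and A: "A \<subseteq> NN"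
  shows "kernel_on NN h `` A \<in> q \<longleftrightarrow> h ` A \<in> beta_map h q"
proof -
  have "h ` A \<subseteq> NN" using h A by blast
  then show ?thesis unfolding kernel_on_Image[OF A] beta_map_def by blast
qed

theorem theorem2p13:
  fixes h :: "nat \<Rightarrow> nat" and \<rho> :: "(nat \<times> nat) set"
  assumes "h \<in> NN \<rightarrow> NN"
    and "\<rho> = kernel_on NN h"
  shows "beta_rel \<rho> = kernel_on betaN (beta_map h)"
proof -
  have "(\<forall>A\<in>p. \<rho> `` A \<in> q) \<longleftrightarrow> beta_map h p = beta_map h q"
    if p: "p \<in> betaN" and q: "q \<in> betaN" for p q
  proof -
    have hp: "beta_map h p \<in> betaN" and hq: "beta_map h q \<in> betaN"
      using beta_map_in_betaN[OF assms(1)] p q by blast+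
    have rel: "\<rho> `` A \<in> q \<longleftrightarrow> h ` A \<in> beta_map h q" if "A \<in> p" for A
      using kernel_Image_in_iff[OF assms(1)] betaN_D(1)[OF p] that assms(2) by blast
    show ?thesis
    proof
      assume L: "\<forall>A\<in>p. \<rho> `` A \<in> q"
      have "beta_map h p \<subseteq> beta_map h q"
      proof
        fix B assume "B \<in> beta_map h p"
        then have B: "B \<subseteq> NN" and A: "h -` B \<inter> NN \<in> p" by (auto simp: beta_map_def)
        have "h ` (h -` B \<inter> NN) \<in> beta_map h q" using L rel[OF A] A by blast
        moreover have "h ` (h -` B \<inter> NN) \<subseteq> B" by blast
        ultimately show "B \<in> beta_map h q" using betaN_D(5)[OF hq] B by blast
      qed
      then show "beta_map h p = beta_map h q" by (rule betaN_subset_imp_eq[OF hp hq])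
    next
      assume eq: "beta_map h p = beta_map h q"
      show "\<forall>A\<in>p. \<rho> `` A \<in> q"
        using image_in_beta_map[OF assms(1) p] rel unfolding eq by blast
    qed
  qed
  then show ?thesis by (auto simp: beta_rel_def kernel_on_def)
qed

end
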